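(* Let $(L,\wedge,\vee)$ be a non-empty lattice equipped with a unary operation $x\mapsto x^{\triangle}$ such that for all $x,y\in L$: (1) $x^{\triangle\triangle}\le x$; (2) $x\le y$ implies $x^{\triangle}\ge y^{\triangle}$; (3) $(x\wedge y)\vee(x\wedge y^{\triangle})=x$. Then $L$ is bounded, i.e. it has a least element $0$ and a greatest element $1$. Consequently the weakly complemented lattices are exactly the non-empty lattices with a unary operation satisfying (1)--(3).
   Context: A weakly complemented lattice is a bounded lattice $(L,\wedge,\vee,0,1)$ together with a unary operation $x\mapsto x^{\triangle}$ satisfying, for all $x,y\in L$: (1) $x^{\triangle\triangle}\le x$; (2) $x\le y\implies x^{\triangle}\ge y^{\triangle}$; (3) $(x\wedge y)\vee(x\wedge y^{\triangle})=x$. Here $x^{\triangle\triangle}$ means $(x^{\triangle})^{\triangle}$. *)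

theory Defs
  imports "HOL-Algebra.Lattice"
begin

definition weak_complementation ::
  "('a, 'b) gorder_scheme \<Rightarrow> ('a \<Rightarrow> 'a) \<Rightarrow> bool" where
  "weak_complementation L tri \<longleftrightarrow>
     tri \<in> carrier L \<rightarrow> carrier L \<and>
     (\<forall>x\<in>carrier L. tri (tri x) \<sqsubseteq>\<^bsub>L\<^esub> x) \<and>
     (\<forall>x\<in>carrier L. \<forall>y\<in>carrier L. x \<sqsubseteq>\<^bsub>L\<^esub> y \<longrightarrow> tri y \<sqsubseteq>\<^bsub>L\<^esub> tri x) \<and>
     (\<forall>x\<in>carrier L. \<forall>y\<in>carrier L.
        (x \<sqinter>\<^bsub>L\<^esub> y) \<squnion>\<^bsub>L\<^esub> (x \<sqinter>\<^bsub>L\<^esub> tri y) = x)"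

text \<open>The constants 0 and 1 are not separate parameters: in a bounded lattice they are
  \<^term>\<open>\<bottom>\<^bsub>L\<^esub>\<close> and \<^term>\<open>\<top>\<^bsub>L\<^esub>\<close>, which are determined by the order.\<close>

locale weakly_complemented_lattice = bounded_lattice L for L (structure) +
  fixes tri :: "'a \<Rightarrow> 'a"
  assumes weak_complementation: "weak_complementation L tri"

end

theory Submission
  imports Defs
begin

text \<open>Axiom (3) gives \<open>x = (x \<sqinter> y) \<squnion> (x \<sqinter> y\<triangle>) \<le> y \<squnion> y\<triangle>\<close> for all \<open>x\<close>, so
  \<open>y \<squnion> y\<triangle>\<close> is the greatest element \<open>1\<close>, for any \<open>y\<close>. Antitonicity applied to
  \<open>x\<triangle> \<le> 1\<close> then gives \<open>1\<triangle> \<le> x\<triangle>\<triangle> \<le> x\<close>, so \<open>1\<triangle>\<close> is the least element.\<close>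

lemma (in lattice) greatest_join_weak_complement:
  assumes wc: "weak_complementation L tri" and y: "y \<in> carrier L"
  shows "greatest L (y \<squnion> tri y) (carrier L)"
proof -
  have ty: "tri y \<in> carrier L"
    using wc y by (auto simp: weak_complementation_def)
  have "x \<sqsubseteq> y \<squnion> tri y" if x: "x \<in> carrier L" for x
  proof -
    \<comment> \<open>Each of the two meets lies below its second factor, which is one of the
      joinands of the bound.\<close>
    have "x \<sqinter> y \<sqsubseteq> y \<squnion> tri y"
      using x y ty by (meson join_closed join_left le_trans meet_closed meet_right)
    moreover have "x \<sqinter> tri y \<sqsubseteq> y \<squnion> tri y"
      using x y ty by (meson join_closed join_right le_trans meet_closed meet_right)
    ultimately have "(x \<sqinter> y) \<squnion> (x \<sqinter> tri y) \<sqsubseteq> y \<squnion> tri y"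
      using x y ty by (simp add: join_le)
    then show ?thesis
      using wc x y by (simp add: weak_complementation_def)
  qed
  then show ?thesis
    using y ty by (auto simp: greatest_def)
qed

lemma (in weak_partial_order) least_weak_complement_greatest:
  assumes wc: "weak_complementation L tri" and u: "greatest L u (carrier L)"
  shows "least L (tri u) (carrier L)"
proof -
  have uL: "u \<in> carrier L" and le_u: "\<And>x. x \<in> carrier L \<Longrightarrow> x \<sqsubseteq> u"
    using u by (auto simp: greatest_def)
  have tri: "\<And>x. x \<in> carrier L \<Longrightarrow> tri x \<in> carrier L"
    using wc by (auto simp: weak_complementation_def)
  have "tri u \<sqsubseteq> x" if x: "x \<in> carrier L" for x
  proof (rule le_trans)
    \<comment> \<open>Closure of the carrier under \<open>tri\<close> makes \<open>le_u\<close>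
      applicable to \<open>tri x\<close>.\<close>
    show "tri u \<sqsubseteq> tri (tri x)"
      using wc uL x tri le_u by (simp add: weak_complementation_def)
    show "tri (tri x) \<sqsubseteq> x"
      using wc x by (simp add: weak_complementation_def)
  qed (use uL x tri in auto)
  then show ?thesis
    using uL tri by (auto simp: least_def)
qed

theorem theorem1:
  fixes L :: "('a, 'b) gorder_scheme" and tri :: "'a \<Rightarrow> 'a"
  shows "(lattice L \<and> carrier L \<noteq> {} \<and> weak_complementation L tri \<longrightarrow>
            (\<exists>z. least L z (carrier L)) \<and> (\<exists>u. greatest L u (carrier L))) \<and>
         (weakly_complemented_lattice L tri \<longleftrightarrow>
            lattice L \<and> carrier L \<noteq> {} \<and> weak_complementation L tri)"
proof -
  have bounds: "(\<exists>z. least L z (carrier L)) \<and> (\<exists>u. greatest L u (carrier L))"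
    if L: "lattice L" and ne: "carrier L \<noteq> {}" and wc: "weak_complementation L tri"
  proof -
    interpret lattice L by (rule L)
    \<comment> \<open>One element suffices to build the top. The empty lattice satisfies the axioms
      vacuously but has no bounds.\<close>
    from ne obtain y where "y \<in> carrier L" by blast
    then have "greatest L (y \<squnion>\<^bsub>L\<^esub> tri y) (carrier L)"
      by (rule greatest_join_weak_complement[OF wc])
    then show ?thesis
      using least_weak_complement_greatest[OF wc] by blast
  qed
  have "weakly_complemented_lattice L tri"
    if L: "lattice L" and ne: "carrier L \<noteq> {}" and wc: "weak_complementation L tri"
  proof -
    interpret lattice L by (rule L)
    show ?thesis
      \<comment> \<open>Boundedness as a locale assumes only that least and greatest elements exist,
        which is what \<open>bounds\<close> supplies.\<close>
      using bounds[OF L ne wc] wc by unfold_locales auto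
  qed
  moreover have "lattice L \<and> carrier L \<noteq> {} \<and> weak_complementation L tri"
    if "weakly_complemented_lattice L tri"
  proof -
    interpret weakly_complemented_lattice L tri by (rule that)
    show ?thesis
      \<comment> \<open>The top element witnesses that the carrier is non-empty.\<close>
      using lattice_axioms top_closed weak_complementation by blast
  qed
  ultimately show ?thesis
    using bounds by blast
qed

end
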